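(* Let $N\ge 2$, let $m_1,\dots,m_N>0$ be masses, $G>0$, and let $q_i^0,v_i^0\in\mathbb{R}^3$ ($1\le i\le N$) satisfy $q_i^0\neq q_j^0$ for all $1\le i<j\le N$. Let $(\hat Q,\hat V)\in\mathbb{R}^{6N}[[\Delta\tau]]$ be the power series in the step-size $\Delta\tau$ associated with one step of the implicit midpoint rule, i.e. satisfying for $1\le i\le N$ $$\hat Q_i=q_i^0+\frac{\Delta\tau}{2}\,s(\hat Q,\hat V)\,\hat V_i,\qquad \hat V_i=v_i^0+\frac{\Delta\tau}{2}\,s(\hat Q,\hat V)\,g_i(\hat Q).$$ Then for $1\le i<j\le N$, $$\hat Q_i-\hat Q_j\trianglelefteq\|q_i^0-q_j^0\|\,\hat\xi,\qquad \hat V_i-\hat V_j\trianglelefteq\|v_i^0-v_j^0\|+s(q^0,v^0)\,M_{ij}(q^0)\,\hat\zeta,$$ where $(\hat\xi,\hat\zeta)\in(1+\Delta\tau\,\mathbb{R}[[\Delta\tau]])\times\Delta\tau\,\mathbb{R}[[\Delta\tau]]$ is the unique fixed point of the operator $$\widehat\Psi(\xi,\zeta)=\left(1+\frac{\Delta\tau}{2}\,(2-\chi(\xi,\zeta))^{-1/2}(1+\zeta),\ \ \frac{\Delta\tau}{2}\,\frac{(2-\chi(\xi,\zeta))^{-1/2}\,\xi}{(2-\xi^2)^{3/2}}\right)$$ defined on $(1+\Delta\tau\,\mathbb{R}[[\Delta\tau]])\times\Delta\tau\,\mathbb{R}[[\Delta\tau]]$, with $\chi(\xi,\zeta)=(2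-\xi^2)^{-1}\big(2\zeta+\zeta^2+(2-\xi^2)^{-1/2}\big)$.
   Context: $\|\cdot\|$ is the Euclidean norm. For $f=\sum_{k\ge0}f_k\Delta\tau^k\in\mathbb{R}^n[[\Delta\tau]]$ and $\bar f=\sum_{k\ge0}\bar f_k\Delta\tau^k\in\mathbb{R}[[\Delta\tau]]$, $f\trianglelefteq\bar f$ means $\|f_k\|\le\bar f_k$ for all $k\ge0$. For a scalar series $p$ with positive constant term and real $\nu$, $p^\nu$ denotes the usual formal power series. For $Q=(Q_1,\dots,Q_N)$, $V=(V_1,\dots,V_N)$ with $Q_i\ne Q_j$ for $i\neq j$: $$g_i(Q)=\sum_{j\neq i}\frac{G\,m_j}{\|Q_i-Q_j\|^3}(Q_j-Q_i),\qquad K_i(Q)=\sum_{j\neq i}\frac{G\,m_j}{\|Q_i-Q_j\|^2},\qquad M_{ij}(Q)=K_i(Q)+K_j(Q),$$ $$s(Q,V)=\left(\sum_{1\le i<j\le N}\frac{\|V_i-V_j\|^2}{\|Q_i-Q_j\|^2}+\sum_{1\le i<j\le N}\frac{M_{ij}(Q)}{\|Q_i-Q_j\|}\right)^{-1/2}.$$ Also $q^0=(q_1^0,\dots,q_N^0)$, $v^0=(v_1^0,\dots,v_N^0)$. The implicit midpoint approximation $(\tilde Q,\tilde V)$, after one step of size $\Delta\tau$, to the solution of $dQ_i/d\tau=s(Q,V)V_i$, $dV_i/d\tau=s(Q,V)g_i(Q)$, $Q_i(0)=q_i^0$, $V_i(0)=v_i^0$ is $\tilde Q_i=q_i^0+\Delta\tau\,s(\hat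 Q,\hat V)\hat V_i$, $\tilde V_i=v_i^0+\Delta\tau\,s(\hat Q,\hat V)g_i(\hat Q)$, so that $(\hat Q,\hat V)=\frac12(q^0+\tilde Q,\,v^0+\tilde V)$. *)

theory Defs
  imports "HOL-Analysis.Analysis" "HOL-Computational_Algebra.Formal_Power_Series"
begin

unbundle no vec_syntax
unbundle fps_syntax

section \<open>Formal power series\<close>

text \<open>
  For \<open>p\<close> with positive constant term \<open>c\<close>, the series \<open>p\<^sup>\<nu> = c\<^sup>\<nu> (1 + (p/c - 1))\<^sup>\<nu>\<close> is
  obtained from the binomial series. The value is only meaningful if \<open>c > 0\<close>.
\<close>

definition fps_rpow :: "real fps \<Rightarrow> real \<Rightarrow> real fps" where
  "fps_rpow p \<nu> = fps_const ((p $ 0) powr \<nu>) * (fps_binomial \<nu> oo (fps_const (1 / p $ 0) * p - 1))"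

lemma fps_rpow_nth_0: "fps_rpow p \<nu> $ 0 = (p $ 0) powr \<nu>"
  by (simp add: fps_rpow_def)

lemma fps_rpow_add:
  assumes "p $ 0 > 0"
  shows "fps_rpow p (\<mu> + \<nu>) = fps_rpow p \<mu> * fps_rpow p \<nu>"
proof -
  have "(fps_const (1 / p $ 0) * p - 1) $ 0 = 0"
    using assms by simp
  then show ?thesis
    by (simp add: fps_rpow_def fps_binomial_add_mult fps_compose_mult_distrib powr_add
        flip: fps_const_mult)
qed

lemma fps_rpow_1:
  assumes "p $ 0 > 0"
  shows "fps_rpow p 1 = p"
  using assms by (simp add: fps_rpow_def fps_binomial_1 fps_compose_add_distrib flip: mult.assoc)

text \<open>
  A series with coefficients in a real inner product space \<open>'a\<close> is an element of \<open>'a fps\<close>. The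
  Cauchy products below extend scalar multiplication and the inner product coefficientwise, and
  \<open>fps_norm f\<close> is the formal series of \<open>\<parallel>f\<parallel>\<close>, meaningful if the constant term of \<open>f\<close> is nonzero.
\<close>

definition fps_scale :: "real fps \<Rightarrow> 'a::real_vector fps \<Rightarrow> 'a fps" (infixr "*\<^sub>F" 75) where
  "p *\<^sub>F f = Abs_fps (\<lambda>n. \<Sum>k=0..n. (p $ k) *\<^sub>R (f $ (n - k)))"

definition fps_inner :: "'a::real_inner fps \<Rightarrow> 'a fps \<Rightarrow> real fps" where
  "fps_inner f h = Abs_fps (\<lambda>n. \<Sum>k=0..n. (f $ k) \<bullet> (h $ (n - k)))"

definition fps_norm :: "'a::real_inner fps \<Rightarrow> real fps" where
  "fps_norm f = fps_rpow (fps_inner f f) (1 / 2)"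

definition fps_majorized :: "'a::real_normed_vector fps \<Rightarrow> real fps \<Rightarrow> bool" (infix "\<unlhd>" 50) where
  "f \<unlhd> h \<longleftrightarrow> (\<forall>k. norm (f $ k) \<le> h $ k)"

lemma fps_norm_nth_0: "fps_norm f $ 0 = norm (f $ 0)"
  by (simp add: fps_norm_def fps_rpow_nth_0 fps_inner_def norm_eq_sqrt_inner powr_half_sqrt)

section \<open>The time-regularised N-body system\<close>

text \<open>
  The bodies are indexed by \<open>{1..N}\<close>; values of \<open>m\<close>, \<open>Q\<close>, \<open>V\<close> outside this range are irrelevant.
\<close>

definition K_bound :: "nat \<Rightarrow> real \<Rightarrow> (nat \<Rightarrow> real) \<Rightarrow> (nat \<Rightarrow> real ^ 3) \<Rightarrow> nat \<Rightarrow> real" where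
  "K_bound N G m Q i = (\<Sum>j\<in>{1..N} - {i}. G * m j / norm (Q i - Q j) ^ 2)"

definition M_bound :: "nat \<Rightarrow> real \<Rightarrow> (nat \<Rightarrow> real) \<Rightarrow> (nat \<Rightarrow> real ^ 3) \<Rightarrow> nat \<Rightarrow> nat \<Rightarrow> real" where
  "M_bound N G m Q i j = K_bound N G m Q i + K_bound N G m Q j"

definition s_fun ::
  "nat \<Rightarrow> real \<Rightarrow> (nat \<Rightarrow> real) \<Rightarrow> (nat \<Rightarrow> real ^ 3) \<Rightarrow> (nat \<Rightarrow> real ^ 3) \<Rightarrow> real" where
  "s_fun N G m Q V =
     ((\<Sum>i\<in>{1..N}. \<Sum>j\<in>{i<..N}. norm (V i - V j) ^ 2 / norm (Q i - Q j) ^ 2) +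
      (\<Sum>i\<in>{1..N}. \<Sum>j\<in>{i<..N}. M_bound N G m Q i j / norm (Q i - Q j))) powr (- 1 / 2)"

text \<open>
  The same functions, and the accelerations \<open>g\<^sub>i\<close>, evaluated at formal power series. Here
  \<open>\<parallel>V\<^sub>i - V\<^sub>j\<parallel>\<^sup>2\<close> is written as an inner product, since \<open>fps_norm\<close> does not make sense for equal
  initial velocities.
\<close>

definition g_fps ::
  "nat \<Rightarrow> real \<Rightarrow> (nat \<Rightarrow> real) \<Rightarrow> (nat \<Rightarrow> (real ^ 3) fps) \<Rightarrow> nat \<Rightarrow> (real ^ 3) fps" where
  "g_fps N G m Q i =
     (\<Sum>j\<in>{1..N} - {i}. (fps_const (G * m j) / fps_norm (Q i - Q j) ^ 3) *\<^sub>F (Q j - Q i))"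

definition K_fps ::
  "nat \<Rightarrow> real \<Rightarrow> (nat \<Rightarrow> real) \<Rightarrow> (nat \<Rightarrow> (real ^ 3) fps) \<Rightarrow> nat \<Rightarrow> real fps" where
  "K_fps N G m Q i = (\<Sum>j\<in>{1..N} - {i}. fps_const (G * m j) / fps_norm (Q i - Q j) ^ 2)"

definition M_fps ::
  "nat \<Rightarrow> real \<Rightarrow> (nat \<Rightarrow> real) \<Rightarrow> (nat \<Rightarrow> (real ^ 3) fps) \<Rightarrow> nat \<Rightarrow> nat \<Rightarrow> real fps" where
  "M_fps N G m Q i j = K_fps N G m Q i + K_fps N G m Q j"

definition s_fps ::
  "nat \<Rightarrow> real \<Rightarrow> (nat \<Rightarrow> real) \<Rightarrow> (nat \<Rightarrow> (real ^ 3) fps) \<Rightarrow> (nat \<Rightarrow> (real ^ 3) fps) \<Rightarrow> real fps" where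
  "s_fps N G m Q V = fps_rpow
     ((\<Sum>i\<in>{1..N}. \<Sum>j\<in>{i<..N}.
         fps_inner (V i - V j) (V i - V j) / fps_norm (Q i - Q j) ^ 2) +
      (\<Sum>i\<in>{1..N}. \<Sum>j\<in>{i<..N}. M_fps N G m Q i j / fps_norm (Q i - Q j))) (- 1 / 2)"

text \<open>
  The step size \<open>\<Delta>\<tau>\<close> is the indeterminate \<open>fps_X\<close>. The equations force the constant terms of
  \<open>Q i\<close> and \<open>V i\<close> to be \<open>q0 i\<close> and \<open>v0 i\<close>, so all powers and quotients are meaningful for
  pairwise distinct \<open>q0 i\<close>.
\<close>

definition midpoint_series ::
  "nat \<Rightarrow> real \<Rightarrow> (nat \<Rightarrow> real) \<Rightarrow> (nat \<Rightarrow> real ^ 3) \<Rightarrow> (nat \<Rightarrow> real ^ 3) \<Rightarrow>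
   (nat \<Rightarrow> (real ^ 3) fps) \<Rightarrow> (nat \<Rightarrow> (real ^ 3) fps) \<Rightarrow> bool" where
  "midpoint_series N G m q0 v0 Q V \<longleftrightarrow>
     (\<forall>i\<in>{1..N}.
        Q i = fps_const (q0 i) + (fps_X / 2 * s_fps N G m Q V) *\<^sub>F V i \<and>
        V i = fps_const (v0 i) + (fps_X / 2 * s_fps N G m Q V) *\<^sub>F g_fps N G m Q i)"

section \<open>The majorant operator\<close>

definition chi :: "real fps \<Rightarrow> real fps \<Rightarrow> real fps" where
  "chi \<xi> \<zeta> = fps_rpow (2 - \<xi>\<^sup>2) (- 1) * (2 * \<zeta> + \<zeta>\<^sup>2 + fps_rpow (2 - \<xi>\<^sup>2) (- 1 / 2))"

definition Psi_domain :: "(real fps \<times> real fps) set" where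
  "Psi_domain = {(\<xi>, \<zeta>). \<xi> $ 0 = 1 \<and> \<zeta> $ 0 = 0}"

definition Psi :: "real fps \<times> real fps \<Rightarrow> real fps \<times> real fps" where
  "Psi = (\<lambda>(\<xi>, \<zeta>).
     (1 + fps_X / 2 * fps_rpow (2 - chi \<xi> \<zeta>) (- 1 / 2) * (1 + \<zeta>),
      fps_X / 2 * (fps_rpow (2 - chi \<xi> \<zeta>) (- 1 / 2) * \<xi> / fps_rpow (2 - \<xi>\<^sup>2) (3 / 2))))"

end

theory Submission
  imports Defs
begin

text \<open>
  The proof is the method of majorants, organised as an induction on the order of truncation.
  Write \<open>d = \<parallel>q\<^sub>i\<^sup>0 - q\<^sub>j\<^sup>0\<parallel>\<close>, \<open>w = \<parallel>v\<^sub>i\<^sup>0 - v\<^sub>j\<^sup>0\<parallel>\<close>, \<open>M = M\<^sub>i\<^sub>j(q\<^sup>0)\<close> and \<open>s\<^sub>0 = s(q\<^sup>0, v\<^sup>0)\<close>, and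
  suppose that \<open>Q\<^sub>i - Q\<^sub>j\<close> and \<open>V\<^sub>i - V\<^sub>j\<close> are majorized by \<open>d \<xi>\<close> and \<open>w + s\<^sub>0 M \<zeta>\<close> up to order \<open>n\<close>,
  for all pairs of bodies. The midpoint equations express both differences as their initial value
  plus \<open>\<Delta>\<tau>\<close> times a series that depends on the same differences, so bounding that series up to order
  \<open>n\<close> gives the claim up to order \<open>n + 1\<close>.

  Three facts make the bounds come out as exactly the components of \<open>Psi\<close>. First, majorization is
  preserved by sums and products, and, since the binomial series of a negative exponent has
  coefficients of alternating sign, \<open>p \<unlhd> c h\<close> with matching constant terms \<open>c\<close> and \<open>h\<^sub>0 = 1\<close> implies
  \<open>p\<^sup>-\<^sup>\<nu> \<unlhd> c\<^sup>-\<^sup>\<nu> (2 - h)\<^sup>-\<^sup>\<nu>\<close> (\<open>fps_rpow_minus_majorized_upto\<close>). Applied to \<open>p = \<parallel>Q\<^sub>i - Q\<^sub>j\<parallel>\<^sup>2 \<unlhd> d\<^sup>2 \<xi>\<^sup>2\<close>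
  this explains the powers of \<open>2 - \<xi>\<^sup>2\<close>. Second, \<open>s\<^sub>0\<^sup>-\<^sup>2\<close> is a sum over pairs of the nonnegative
  numbers \<open>w\<^sup>2 / d\<^sup>2\<close> and \<open>M / d\<close>, so each of these is at most \<open>s\<^sub>0\<^sup>-\<^sup>2\<close>; equivalently \<open>s\<^sub>0 w \<le> d\<close> and
  \<open>s\<^sub>0\<^sup>2 M \<le> d\<close>, which removes the velocities and masses from all coefficients. Third, the
  contribution of each pair to the series \<open>s(Q, V)\<^sup>-\<^sup>2\<close> is majorized by its constant term times
  \<open>chi \<xi> \<zeta>\<close> (\<open>T_maj\<close>), hence so is their sum, and \<open>s(Q, V)\<close> is majorized by \<open>s\<^sub>0 (2 - \<chi>)\<^sup>-\<^sup>1\<^sup>/\<^sup>2\<close>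
  (\<open>s_maj\<close>).

  The fixed point exists and is unique because \<open>Psi\<close> multiplies by \<open>\<Delta>\<tau>\<close>: coefficients up to order
  \<open>n\<close> of the argument determine those of the value up to order \<open>n + 1\<close>, so \<open>Psi\<close> is a contraction
  for the metric in which series are close when they agree to high order.
\<close>

section \<open>Majorization up to a given order\<close>

text \<open>
  The induction needs a truncated form of majorization: a bound up to order \<open>n\<close> on the unknown series
  must yield a bound up to order \<open>n\<close> on every expression built from them.
\<close>

definition majorized_upto ::
  "'a::real_normed_vector fps \<Rightarrow> nat \<Rightarrow> real fps \<Rightarrow> bool" ("(_ \<unlhd>[_] _)" [51, 0, 51] 50) where
  "f \<unlhd>[n] h \<longleftrightarrow> (\<forall>k\<le>n. norm (f $ k) \<le> h $ k)"

lemma fps_majorized_iff: "f \<unlhd> h \<longleftrightarrow> (\<forall>n. f \<unlhd>[n] h)"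
  by (auto simp: fps_majorized_def majorized_upto_def)

lemma majorized_upto_nonneg:
  assumes "f \<unlhd>[n] h" and "k \<le> n"
  shows "0 \<le> h $ k"
  using assms unfolding majorized_upto_def by (meson norm_ge_zero order_trans)

lemma zero_majorized_upto_iff: "0 \<unlhd>[n] h \<longleftrightarrow> (\<forall>k\<le>n. 0 \<le> h $ k)"
  by (simp add: majorized_upto_def)

abbreviation nonneg_upto :: "nat \<Rightarrow> real fps \<Rightarrow> bool" where
  "nonneg_upto n h \<equiv> (0 :: real fps) \<unlhd>[n] h"

lemma majorized_upto_trans:
  fixes h :: "real fps"
  assumes "f \<unlhd>[n] h" and "h \<unlhd>[n] h'"
  shows "f \<unlhd>[n] h'"
  using assms unfolding majorized_upto_def by (metis abs_ge_self order_trans real_norm_def)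

lemma majorized_upto_add:
  assumes "f \<unlhd>[n] h" and "f' \<unlhd>[n] h'"
  shows "f + f' \<unlhd>[n] h + h'"
  using assms unfolding majorized_upto_def by (auto intro: norm_triangle_le add_mono)

lemma majorized_upto_minus_commute: "f - g \<unlhd>[n] h \<longleftrightarrow> g - f \<unlhd>[n] h"
  by (simp add: majorized_upto_def norm_minus_commute)

lemma majorized_upto_diff:
  assumes "f \<unlhd>[n] h" and "f' \<unlhd>[n] h'"
  shows "f - f' \<unlhd>[n] h + h'"
  using assms unfolding majorized_upto_def
  by (auto intro: order_trans[OF norm_triangle_ineq4] add_mono)

lemma majorized_upto_refl:
  fixes h :: "real fps"
  shows "nonneg_upto n h \<Longrightarrow> h \<unlhd>[n] h"
  by (simp add: majorized_upto_def)

lemma majorized_upto_sum: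
  assumes "\<And>x. x \<in> A \<Longrightarrow> f x \<unlhd>[n] h x"
  shows "(\<Sum>x\<in>A. f x) \<unlhd>[n] (\<Sum>x\<in>A. h x)"
  using assms unfolding majorized_upto_def by (auto simp: fps_sum_nth intro: sum_norm_le)

lemma majorized_upto_const: "norm c \<le> a \<Longrightarrow> fps_const c \<unlhd>[n] fps_const a"
  by (simp add: majorized_upto_def)

text \<open>
  Scalar multiplication, the inner product and the product of real series are all Cauchy products
  for a pairing \<open>b\<close> with \<open>norm (b x y) \<le> norm x * norm y\<close>, so one estimate serves all three.
\<close>

lemma majorized_upto_convolution:
  fixes b :: "'a::real_normed_vector \<Rightarrow> 'b::real_normed_vector \<Rightarrow> 'c::real_normed_vector"
  assumes b: "\<And>x y. norm (b x y) \<le> norm x * norm y"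
    and f: "f \<unlhd>[n] h" and f': "f' \<unlhd>[n] h'"
  shows "Abs_fps (\<lambda>n. \<Sum>k=0..n. b (f $ k) (f' $ (n - k))) \<unlhd>[n] h * h'"
  unfolding majorized_upto_def
proof (intro allI impI)
  fix k assume k: "k \<le> n"
  have "norm (\<Sum>i=0..k. b (f $ i) (f' $ (k - i))) \<le> (\<Sum>i=0..k. h $ i * h' $ (k - i))"
  proof (rule sum_norm_le)
    fix i assume i: "i \<in> {0..k}"
    then have "norm (f $ i) \<le> h $ i" "norm (f' $ (k - i)) \<le> h' $ (k - i)"
      using f f' k by (auto simp: majorized_upto_def)
    then show "norm (b (f $ i) (f' $ (k - i))) \<le> h $ i * h' $ (k - i)"
      by (meson b mult_mono norm_ge_zero order_trans)
  qed
  then show "norm (Abs_fps (\<lambda>n. \<Sum>k=0..n. b (f $ k) (f' $ (n - k))) $ k) \<le> (h * h') $ k"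
    by (simp add: fps_mult_nth)
qed

lemma majorized_upto_mult:
  fixes f f' :: "real fps"
  assumes "f \<unlhd>[n] h" and "f' \<unlhd>[n] h'"
  shows "f * f' \<unlhd>[n] h * h'"
proof -
  have "Abs_fps (\<lambda>n. \<Sum>k=0..n. f $ k * f' $ (n - k)) \<unlhd>[n] h * h'"
    by (rule majorized_upto_convolution[OF _ assms]) (simp add: abs_mult)
  then show ?thesis by (simp only: fps_times_def)
qed

lemma majorized_upto_scale: "p \<unlhd>[n] h \<Longrightarrow> f \<unlhd>[n] h' \<Longrightarrow> p *\<^sub>F f \<unlhd>[n] h * h'"
  unfolding fps_scale_def by (rule majorized_upto_convolution) simp_all

lemma majorized_upto_inner: "f \<unlhd>[n] h \<Longrightarrow> f' \<unlhd>[n] h' \<Longrightarrow> fps_inner f f' \<unlhd>[n] h * h'"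
  unfolding fps_inner_def by (rule majorized_upto_convolution) (simp_all add: Cauchy_Schwarz_ineq2)

lemma majorized_upto_power:
  fixes f :: "real fps"
  assumes "f \<unlhd>[n] h"
  shows "f ^ k \<unlhd>[n] h ^ k"
proof (induction k)
  case 0
  show ?case using majorized_upto_const[of "1::real" 1] by simp
qed (simp add: majorized_upto_mult[OF assms])

lemma fps_X_mult_majorized_upto:
  fixes f :: "real fps"
  assumes "f \<unlhd>[n] h"
  shows "fps_X * f \<unlhd>[Suc n] fps_X * h"
  using assms by (auto simp: majorized_upto_def)

text \<open>
  This is the step that gains an order. The factor \<open>fps_X\<close> has to sit on the scalar, because it
  cannot multiply a vector-valued series directly.
\<close>

lemma fps_X_mult_scale_majorized_upto:
  assumes "p \<unlhd>[n] h" and "f \<unlhd>[n] h'"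
  shows "(fps_X * p) *\<^sub>F f \<unlhd>[Suc n] fps_X * (h * h')"
  unfolding majorized_upto_def
proof (intro allI impI)
  fix k assume k: "k \<le> Suc n"
  show "norm (((fps_X * p) *\<^sub>F f) $ k) \<le> (fps_X * (h * h')) $ k"
  proof (cases k)
    case 0
    then show ?thesis by (simp add: fps_scale_def)
  next
    case (Suc l)
    have "((fps_X * p) *\<^sub>F f) $ k = (p *\<^sub>F f) $ l"
      by (simp add: Suc fps_scale_def sum.atLeast0_atMost_Suc_shift del: sum.cl_ivl_Suc)
    then show ?thesis
      using majorized_upto_scale[OF assms] k by (simp add: Suc majorized_upto_def)
  qed
qed

lemma fps_scale_diff_right: "p *\<^sub>F (f - f') = p *\<^sub>F f - p *\<^sub>F f'"
  by (simp add: fps_scale_def fps_eq_iff scaleR_diff_right sum_subtractf)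

lemma sum_fps_const_mult:
  fixes h :: "'a::comm_ring_1 fps"
  shows "(\<Sum>x\<in>A. fps_const (c x) * h) = fps_const (\<Sum>x\<in>A. c x) * h"
  by (simp add: fps_eq_iff fps_sum_nth sum_distrib_right)

section \<open>Real powers of power series\<close>

lemma fps_rpow_0 [simp]:
  assumes "p $ 0 > 0"
  shows "fps_rpow p 0 = 1"
  using assms by (simp add: fps_rpow_def)

lemma fps_rpow_power:
  assumes "p $ 0 > 0"
  shows "fps_rpow p \<nu> ^ k = fps_rpow p (real k * \<nu>)"
  using assms by (induction k) (simp_all add: fps_rpow_add[symmetric] algebra_simps)

lemma inverse_fps_rpow:
  assumes "p $ 0 > 0"
  shows "inverse (fps_rpow p \<nu>) = fps_rpow p (- \<nu>)"
proof -
  have "fps_rpow p \<nu> * fps_rpow p (- \<nu>) = 1"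
    using assms by (simp flip: fps_rpow_add)
  then show ?thesis
    by (rule fps_inverse_unique)
qed

text \<open>
  Put \<open>r = p / c - 1\<close> for the constant term \<open>c\<close> of \<open>p\<close>, so that \<open>p\<^sup>-\<^sup>\<nu> = c\<^sup>-\<^sup>\<nu> (1 + r)\<^sup>-\<^sup>\<nu>\<close> and \<open>r\<close> is
  majorized by \<open>h - 1\<close>. The coefficient of \<open>r\<^sup>i\<close> in \<open>(1 + r)\<^sup>-\<^sup>\<nu>\<close> has absolute value
  \<open>pochhammer \<nu> i / fact i\<close>, which is the coefficient of \<open>(h - 1)\<^sup>i\<close> in
  \<open>(1 - (h - 1))\<^sup>-\<^sup>\<nu> = (2 - h)\<^sup>-\<^sup>\<nu>\<close>.
\<close>

lemma fps_rpow_minus_majorized_upto: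
  assumes \<nu>: "\<nu> > 0" and p0: "p $ 0 > 0" and h0: "h $ 0 = 1"
    and maj: "p \<unlhd>[n] fps_const (p $ 0) * h"
  shows "fps_rpow p (- \<nu>) \<unlhd>[n] fps_const ((p $ 0) powr (- \<nu>)) * fps_rpow (2 - h) (- \<nu>)"
proof -
  define r where "r = fps_const (1 / p $ 0) * p - 1"
  have "r \<unlhd>[n] h - 1"
    unfolding majorized_upto_def
  proof (intro allI impI)
    fix k assume "k \<le> n"
    then have "\<bar>p $ k\<bar> \<le> p $ 0 * h $ k"
      using maj by (simp add: majorized_upto_def)
    then show "norm (r $ k) \<le> (h - 1) $ k"
      using p0 h0 by (cases "k = 0") (simp_all add: r_def field_simps)
  qed
  then have pow: "r ^ i \<unlhd>[n] (h - 1) ^ i" for i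
    by (rule majorized_upto_power)
  have coeff: "\<bar>(- \<nu>) gchoose i\<bar> = pochhammer \<nu> i / fact i" for i
    using pochhammer_nonneg[OF \<nu>, of i] by (simp add: gbinomial_pochhammer abs_mult)
  have "fps_binomial (- \<nu>) oo r \<unlhd>[n] fps_binomial (- \<nu>) oo (1 - h)"
    unfolding majorized_upto_def
  proof (intro allI impI)
    fix k assume k: "k \<le> n"
    have "norm ((fps_binomial (- \<nu>) oo r) $ k)
        \<le> (\<Sum>i=0..k. pochhammer \<nu> i / fact i * ((h - 1) ^ i) $ k)"
      unfolding fps_compose_nth
    proof (rule sum_norm_le)
      fix i
      have "\<bar>(r ^ i) $ k\<bar> \<le> ((h - 1) ^ i) $ k"
        using pow k by (simp add: majorized_upto_def)
      then show "norm (fps_binomial (- \<nu>) $ i * (r ^ i) $ k)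
          \<le> pochhammer \<nu> i / fact i * ((h - 1) ^ i) $ k"
        using pochhammer_nonneg[OF \<nu>, of i]
        by (simp add: abs_mult coeff mult_left_mono divide_right_mono)
    qed
    also have "\<dots> = (fps_binomial (- \<nu>) oo (1 - h)) $ k"
      unfolding fps_compose_nth
    proof (rule sum.cong)
      fix i
      have "(1 - h) ^ i = fps_const ((- 1) ^ i) * (h - 1) ^ i"
        using power_minus[of "h - 1" i] by (simp flip: fps_const_neg fps_const_power)
      then show "pochhammer \<nu> i / fact i * ((h - 1) ^ i) $ k
          = fps_binomial (- \<nu>) $ i * ((1 - h) ^ i) $ k"
        by (simp add: gbinomial_pochhammer flip: power_mult_distrib)
    qed simp
    finally show "norm ((fps_binomial (- \<nu>) oo r) $ k) \<le> (fps_binomial (- \<nu>) oo (1 - h)) $ k" .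
  qed
  moreover have "fps_rpow (2 - h) (- \<nu>) = fps_binomial (- \<nu>) oo (1 - h)"
    using h0 by (simp add: fps_rpow_def algebra_simps)
  ultimately show ?thesis
    by (simp add: fps_rpow_def r_def majorized_upto_mult majorized_upto_const)
qed

text \<open>
  The series \<open>fps_norm f\<close> is the square root of \<open>fps_inner f f\<close>, which is
  majorized by \<open>(norm (f $ 0))\<^sup>2 \<xi>\<^sup>2\<close>, and the previous bound on negative powers applies with
  exponent \<open>- k / 2\<close>.
\<close>

lemma fps_inverse_norm_power_majorized_upto:
  fixes f :: "'a::real_inner fps"
  assumes f0: "f $ 0 \<noteq> 0" and \<xi>0: "\<xi> $ 0 = 1" and k: "k > 0"
    and maj: "f \<unlhd>[n] fps_const (norm (f $ 0)) * \<xi>"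
  shows "inverse (fps_norm f ^ k)
    \<unlhd>[n] fps_const (1 / norm (f $ 0) ^ k) * fps_rpow (2 - \<xi>\<^sup>2) (- (real k / 2))"
proof -
  define a where "a = norm (f $ 0)"
  have a: "a > 0" using f0 by (simp add: a_def)
  have P0: "fps_inner f f $ 0 = a\<^sup>2"
    by (simp add: fps_inner_def a_def power2_norm_eq_inner)
  have "fps_inner f f \<unlhd>[n] fps_const (fps_inner f f $ 0) * \<xi>\<^sup>2"
    using majorized_upto_inner[OF maj maj] unfolding P0
    by (simp add: a_def power2_eq_square mult_ac flip: fps_const_mult)
  then have "fps_rpow (fps_inner f f) (- (real k / 2))
      \<unlhd>[n] fps_const (a\<^sup>2 powr (- (real k / 2))) * fps_rpow (2 - \<xi>\<^sup>2) (- (real k / 2))"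
    using fps_rpow_minus_majorized_upto[of "real k / 2" "fps_inner f f" "\<xi>\<^sup>2" n] a k P0 \<xi>0
    by (simp add: fps_power_zeroth)
  moreover have "a\<^sup>2 powr (- (real k / 2)) = 1 / a ^ k"
  proof -
    have "a\<^sup>2 powr (- (real k / 2)) = (a powr 2) powr (- (real k / 2))"
      using a by simp
    also have "\<dots> = a powr (- real k)"
      unfolding powr_powr by simp
    also have "\<dots> = 1 / a ^ k"
      using a by (simp add: powr_minus powr_realpow divide_inverse)
    finally show ?thesis .
  qed
  moreover have "inverse (fps_norm f ^ k) = fps_rpow (fps_inner f f) (- (real k / 2))"
    using a P0 by (simp add: fps_norm_def fps_rpow_power inverse_fps_rpow)
  ultimately show ?thesis by (simp add: a_def)
qed

text \<open>
  The special case \<open>p = 1\<close>; it says in particular that the majorants \<open>(2 - h)\<^sup>-\<^sup>\<nu>\<close> have nonnegative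
  coefficients.
\<close>

lemma one_majorized_upto_fps_rpow_minus:
  assumes \<nu>: "\<nu> > 0" and h0: "h $ 0 = 1" and h: "nonneg_upto n h"
  shows "(1 :: real fps) \<unlhd>[n] fps_rpow (2 - h) (- \<nu>)"
proof -
  have "(1 :: real fps) \<unlhd>[n] fps_const 1 * h"
    using h0 h by (simp add: majorized_upto_def)
  then have "fps_rpow 1 (- \<nu>) \<unlhd>[n] fps_rpow (2 - h) (- \<nu>)"
    using fps_rpow_minus_majorized_upto[OF \<nu> _ h0, of 1 n] by simp
  moreover have "fps_rpow 1 (- \<nu>) = 1"
    by (simp add: fps_rpow_def)
  ultimately show ?thesis by simp
qed

section \<open>Agreement of coefficients and fixed points\<close>

definition agree_upto :: "nat \<Rightarrow> 'a fps \<Rightarrow> 'a fps \<Rightarrow> bool" where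
  "agree_upto n f h \<longleftrightarrow> (\<forall>k\<le>n. f $ k = h $ k)"

lemma agree_upto_refl: "agree_upto n f f"
  by (simp add: agree_upto_def)

lemma agree_upto_add:
  "agree_upto n f f' \<Longrightarrow> agree_upto n h h' \<Longrightarrow> agree_upto n (f + h) (f' + h')"
  by (simp add: agree_upto_def)

lemma agree_upto_diff:
  "agree_upto n f f' \<Longrightarrow> agree_upto n h h' \<Longrightarrow> agree_upto n (f - h) (f' - h')"
  by (simp add: agree_upto_def)

lemma agree_upto_mult:
  "agree_upto n f f' \<Longrightarrow> agree_upto n h h' \<Longrightarrow> agree_upto n (f * h) (f' * h')"
  by (auto simp: agree_upto_def fps_mult_nth intro!: sum.cong)

lemma agree_upto_power: "agree_upto n f f' \<Longrightarrow> agree_upto n (f ^ k) (f' ^ k)"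
  by (induction k) (simp_all add: agree_upto_refl agree_upto_mult)

lemma agree_upto_fps_rpow:
  assumes "agree_upto n f f'"
  shows "agree_upto n (fps_rpow f \<nu>) (fps_rpow f' \<nu>)"
proof -
  have "f $ 0 = f' $ 0" using assms by (simp add: agree_upto_def)
  moreover have "agree_upto n ((fps_const c * f - 1) ^ i) ((fps_const c * f' - 1) ^ i)" for i c
    by (intro agree_upto_power agree_upto_diff agree_upto_mult agree_upto_refl assms)
  ultimately have "agree_upto n (fps_binomial \<nu> oo (fps_const (1 / f $ 0) * f - 1))
     (fps_binomial \<nu> oo (fps_const (1 / f' $ 0) * f' - 1))"
    by (simp add: agree_upto_def fps_compose_nth)
  then show ?thesis
    using \<open>f $ 0 = f' $ 0\<close> unfolding fps_rpow_def
    by (simp add: agree_upto_mult agree_upto_refl)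
qed

lemmas agree_upto_intros = agree_upto_refl agree_upto_add agree_upto_diff agree_upto_mult
  agree_upto_power agree_upto_fps_rpow

lemma agree_upto_X_mult:
  "agree_upto n f f' \<Longrightarrow> agree_upto (Suc n) (fps_X * f) (fps_X * f' :: 'a::comm_ring_1 fps)"
  by (auto simp: agree_upto_def)

text \<open>
  Banach's fixed point theorem for the metric of agreement to high order. Prescribing the constant
  terms makes any two points of the domain agree up to order 0, which starts the induction both for
  the convergence of the iterates and for uniqueness.
\<close>

lemma ex1_fixed_point_fps_pair:
  fixes F :: "'a::zero fps \<times> 'b::zero fps \<Rightarrow> 'a fps \<times> 'b fps" and a b
  defines "D \<equiv> {(f, h). f $ 0 = a \<and> h $ 0 = b}"
  assumes F: "\<And>p. p \<in> D \<Longrightarrow> F p \<in> D"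
    and contract: "\<And>n f h f' h'. (f, h) \<in> D \<Longrightarrow> (f', h') \<in> D \<Longrightarrow>
      agree_upto n f f' \<Longrightarrow> agree_upto n h h' \<Longrightarrow>
      agree_upto (Suc n) (fst (F (f, h))) (fst (F (f', h'))) \<and>
      agree_upto (Suc n) (snd (F (f, h))) (snd (F (f', h')))"
  shows "\<exists>!p. p \<in> D \<and> F p = p"
proof -
  define A where "A n p p' \<longleftrightarrow> agree_upto n (fst p) (fst p') \<and> agree_upto n (snd p) (snd p')" 
    for n and p p' :: "'a fps \<times> 'b fps"
  have A_Suc: "A (Suc n) (F p) (F p')" if "p \<in> D" "p' \<in> D" "A n p p'" for n p p'
    using contract[of "fst p" "snd p" "fst p'" "snd p'" n] that by (simp add: A_def)
  have A_0: "A 0 p p'" if "p \<in> D" "p' \<in> D" for p p'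
    using that by (auto simp: A_def D_def agree_upto_def)
  have A_eq: "p = p'" if "\<And>n. A n p p'" for p p'
    using that by (auto simp: A_def agree_upto_def prod_eq_iff fps_eq_iff)
  define p where "p n = (F ^^ n) (fps_const a, fps_const b)" for n
  have p: "p n \<in> D" for n
    by (induction n) (simp_all add: p_def F, simp add: D_def)
  have step: "A n (p n) (p (Suc n))" for n
  proof (induction n)
    case 0
    show ?case by (rule A_0[OF p p])
  next
    case (Suc n)
    show ?case using A_Suc[OF p p Suc.IH] by (simp add: p_def)
  qed
  (* The n-th coefficient no longer changes from the n-th iterate on, so the diagonal is the limit. *)
  define q where "q = (Abs_fps (\<lambda>n. fst (p n) $ n), Abs_fps (\<lambda>n. snd (p n) $ n))"
  have stable: "fst (p (n + d)) $ n = fst (p n) $ n \<and> snd (p (n + d)) $ n = snd (p n) $ n" for n d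
  proof (induction d)
    case (Suc d)
    then show ?case using step[of "n + d"] by (simp add: A_def agree_upto_def)
  qed simp
  have lim: "A n q (p n)" for n
    unfolding A_def agree_upto_def
  proof (intro conjI allI impI)
    fix k assume "k \<le> n"
    then obtain d where "n = k + d" by (auto dest: le_Suc_ex)
    then show "fst q $ k = fst (p n) $ k" "snd q $ k = snd (p n) $ k"
      using stable[of k d] by (simp_all add: q_def)
  qed
  have q: "q \<in> D"
    using p[of 0] by (auto simp: q_def D_def)
  have "A n (F q) q" for n
  proof -
    have "A (Suc n) (F q) (p (Suc n))"
      using A_Suc[OF q p lim] by (simp add: p_def)
    then show ?thesis
      using lim[of "Suc n"] by (simp add: A_def agree_upto_def)
  qed
  then have "F q = q" by (rule A_eq)
  moreover have "p = q" if "p \<in> D" "F p = p" for p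
  proof (rule A_eq)
    show "A n p q" for n
    proof (induction n)
      case 0
      show ?case by (rule A_0[OF that(1) q])
    next
      case (Suc n)
      then show ?case using A_Suc[OF that(1) q] that(2) \<open>F q = q\<close> by simp
    qed
  qed
  ultimately show ?thesis using q by blast
qed

section \<open>The majorant operator\<close>

lemma fps_divide_fps_rpow:
  assumes "p $ 0 > 0"
  shows "f / fps_rpow p \<nu> = f * fps_rpow p (- \<nu>)"
  using assms by (simp add: fps_divide_unit fps_rpow_nth_0 inverse_fps_rpow)

lemma fps_X_half: "(fps_X :: real fps) / 2 = fps_X * fps_const (1 / 2)"
  by (simp add: fps_divide_unit numeral_fps_const fps_const_inverse)

lemma chi_nth_0:
  assumes "\<xi> $ 0 = 1" and "\<zeta> $ 0 = 0"
  shows "chi \<xi> \<zeta> $ 0 = 1"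
  using assms by (simp add: chi_def fps_rpow_nth_0 fps_power_zeroth)

text \<open>
  Moving \<open>fps_X\<close> to the front and turning the quotient into a negative power puts both components
  into the form in which the contraction estimate and the majorants are computed.
\<close>

lemma Psi_eq:
  assumes "\<xi> $ 0 = 1"
  shows "Psi (\<xi>, \<zeta>) =
     (1 + fps_X * (fps_const (1 / 2) * (fps_rpow (2 - chi \<xi> \<zeta>) (- 1 / 2) * (1 + \<zeta>))),
      fps_X * (fps_const (1 / 2) *
        (fps_rpow (2 - chi \<xi> \<zeta>) (- 1 / 2) * (\<xi> * fps_rpow (2 - \<xi>\<^sup>2) (- 3 / 2)))))"
  using assms
  by (simp add: Psi_def fps_X_half fps_divide_fps_rpow fps_power_zeroth mult_ac)

lemma ex1_Psi_fixed_point: "\<exists>!p. p \<in> Psi_domain \<and> Psi p = p"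
  unfolding Psi_domain_def
proof (rule ex1_fixed_point_fps_pair)
  fix p :: "real fps \<times> real fps"
  assume "p \<in> {(\<xi>, \<zeta>). \<xi> $ 0 = 1 \<and> \<zeta> $ 0 = 0}"
  then show "Psi p \<in> {(\<xi>, \<zeta>). \<xi> $ 0 = 1 \<and> \<zeta> $ 0 = 0}"
    by (auto simp: Psi_eq)
next
  fix n and \<xi> \<zeta> \<xi>' \<zeta>' :: "real fps"
  assume dom: "(\<xi>, \<zeta>) \<in> {(\<xi>, \<zeta>). \<xi> $ 0 = 1 \<and> \<zeta> $ 0 = 0}" "(\<xi>', \<zeta>') \<in> {(\<xi>, \<zeta>). \<xi> $ 0 = 1 \<and> \<zeta> $ 0 = 0}"
    and agree: "agree_upto n \<xi> \<xi>'" "agree_upto n \<zeta> \<zeta>'"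
  have "agree_upto n (chi \<xi> \<zeta>) (chi \<xi>' \<zeta>')"
    unfolding chi_def by (intro agree_upto_intros agree)
  then show "agree_upto (Suc n) (fst (Psi (\<xi>, \<zeta>))) (fst (Psi (\<xi>', \<zeta>'))) \<and>
      agree_upto (Suc n) (snd (Psi (\<xi>, \<zeta>))) (snd (Psi (\<xi>', \<zeta>')))"
    using dom agree
    by (simp add: Psi_eq) (intro conjI agree_upto_intros agree_upto_X_mult)
qed

section \<open>The midpoint series of the N-body system\<close>

locale nbody_series =
  fixes N :: nat and G :: real and m :: "nat \<Rightarrow> real"
    and q0 v0 :: "nat \<Rightarrow> real ^ 3"
    and Q V :: "nat \<Rightarrow> (real ^ 3) fps"
  assumes N: "N \<ge> 2"
    and G: "G > 0"
    and m: "\<And>i. i \<in> {1..N} \<Longrightarrow> m i > 0"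
    and distinct: "\<And>i j. i \<in> {1..N} \<Longrightarrow> j \<in> {1..N} \<Longrightarrow> i \<noteq> j \<Longrightarrow> q0 i \<noteq> q0 j"
    and Q_0: "\<And>i. i \<in> {1..N} \<Longrightarrow> Q i $ 0 = q0 i"
    and V_0: "\<And>i. i \<in> {1..N} \<Longrightarrow> V i $ 0 = v0 i"
begin

abbreviation d :: "nat \<Rightarrow> nat \<Rightarrow> real" where "d i j \<equiv> norm (q0 i - q0 j)"
abbreviation w :: "nat \<Rightarrow> nat \<Rightarrow> real" where "w i j \<equiv> norm (v0 i - v0 j)"
abbreviation K :: "nat \<Rightarrow> real" where "K \<equiv> K_bound N G m q0"
abbreviation M :: "nat \<Rightarrow> nat \<Rightarrow> real" where "M \<equiv> M_bound N G m q0"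
abbreviation s0 :: real where "s0 \<equiv> s_fun N G m q0 v0"
abbreviation pairs :: "(nat \<times> nat) set" where "pairs \<equiv> Sigma {1..N} (\<lambda>i. {i<..N})"

text \<open>
  The contribution of one pair of bodies to \<open>s(q\<^sup>0, v\<^sup>0)\<^sup>-\<^sup>2\<close>, and the sum of all of them, so that
  \<open>s0 = \<sigma>\<^sup>-\<^sup>1\<^sup>/\<^sup>2\<close>.
\<close>

definition \<tau> :: "nat \<Rightarrow> nat \<Rightarrow> real" where "\<tau> i j = (w i j)\<^sup>2 / (d i j)\<^sup>2 + M i j / d i j"
definition \<sigma> :: real where "\<sigma> = (\<Sum>(i, j)\<in>pairs. \<tau> i j)"

lemma d_pos: "i \<in> {1..N} \<Longrightarrow> j \<in> {1..N} \<Longrightarrow> i \<noteq> j \<Longrightarrow> d i j > 0"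
  using distinct by auto

lemma K_pos:
  assumes i: "i \<in> {1..N}"
  shows "K i > 0"
  unfolding K_bound_def
proof (rule sum_pos)
  have "(if i = 1 then 2 else 1) \<in> {1..N} - {i}"
    using N by auto
  then show "{1..N} - {i} \<noteq> {}" by blast
  show "0 < G * m j / (d i j)\<^sup>2" if "j \<in> {1..N} - {i}" for j
    using that G m[of j] d_pos[OF i, of j] by auto
qed simp

lemma M_pos: "i \<in> {1..N} \<Longrightarrow> j \<in> {1..N} \<Longrightarrow> M i j > 0"
  using K_pos[of i] K_pos[of j] by (simp add: M_bound_def)

lemma \<tau>_pos: "i \<in> {1..N} \<Longrightarrow> j \<in> {1..N} \<Longrightarrow> i \<noteq> j \<Longrightarrow> \<tau> i j > 0"
  using d_pos[of i j] M_pos[of i j] unfolding \<tau>_def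
  by (intro add_nonneg_pos) auto

lemma \<tau>_commute: "\<tau> i j = \<tau> j i"
  by (simp add: \<tau>_def norm_minus_commute M_bound_def add.commute)

lemma \<tau>_le_\<sigma>:
  assumes "i \<in> {1..N}" and "j \<in> {1..N}" and "i \<noteq> j"
  shows "\<tau> i j \<le> \<sigma>"
proof -
  have le: "\<tau> i j \<le> \<sigma>" if "(i, j) \<in> pairs" for i j
    unfolding \<sigma>_def
    using member_le_sum[OF that, of "\<lambda>(i, j). \<tau> i j"] \<tau>_pos by (fastforce intro: less_imp_le)
  show ?thesis
    using le[of i j] le[of j i] \<tau>_commute[of i j] assms by (cases "i < j") auto
qed

lemma \<sigma>_pos: "\<sigma> > 0"
  using \<tau>_pos[of 1 2] \<tau>_le_\<sigma>[of 1 2] N by simp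

lemma s0_eq: "s0 = \<sigma> powr (- 1 / 2)"
  by (simp add: s_fun_def \<sigma>_def \<tau>_def sum.Sigma sum.distrib case_prod_beta)

lemma s0_pos: "s0 > 0"
  using \<sigma>_pos by (simp add: s0_eq)

lemma s0_square: "s0\<^sup>2 * \<sigma> = 1"
proof -
  have "s0\<^sup>2 = \<sigma> powr (- 1)"
    unfolding s0_eq power2_eq_square powr_add[symmetric] by simp
  then show ?thesis
    using \<sigma>_pos by (simp add: powr_minus)
qed

text \<open>
  A single pair contributes at most the whole sum \<open>\<sigma> = s0\<^sup>-\<^sup>2\<close>, hence so does each of its two
  nonnegative parts.
\<close>

lemma
  assumes "i \<in> {1..N}" and "j \<in> {1..N}" and "i \<noteq> j"
  shows s0_w_le_d: "s0 * w i j \<le> d i j"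
    and s0_square_M_le_d: "s0\<^sup>2 * M i j \<le> d i j"
proof -
  have d: "d i j > 0" and M: "M i j > 0"
    using assms d_pos M_pos by auto
  have "s0\<^sup>2 * \<tau> i j \<le> 1"
    using mult_left_mono[OF \<tau>_le_\<sigma>[OF assms], of "s0\<^sup>2"] s0_square by simp
  moreover have "s0\<^sup>2 * \<tau> i j = (s0 * w i j / d i j)\<^sup>2 + s0\<^sup>2 * M i j / d i j"
    by (simp add: \<tau>_def power_divide power_mult_distrib distrib_left)
  moreover have "0 \<le> (s0 * w i j / d i j)\<^sup>2" "0 \<le> s0\<^sup>2 * M i j / d i j"
    using d M by auto
  ultimately have "(s0 * w i j / d i j)\<^sup>2 \<le> 1\<^sup>2" "s0\<^sup>2 * M i j / d i j \<le> 1"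
    unfolding one_power2 by linarith+
  then have "s0 * w i j / d i j \<le> 1" "s0\<^sup>2 * M i j / d i j \<le> 1"
    by (simp_all only: power2_le_imp_le[OF _ zero_le_one])
  then show "s0 * w i j \<le> d i j" "s0\<^sup>2 * M i j \<le> d i j"
    using d by (simp_all add: divide_le_eq)
qed

lemma fps_divide_norm_power:
  assumes "i \<in> {1..N}" and "j \<in> {1..N}" and "i \<noteq> j"
  shows "f / fps_norm (Q i - Q j) ^ k = f * inverse (fps_norm (Q i - Q j) ^ k)"
  using assms distinct[of i j] by (simp add: fps_divide_unit fps_norm_nth_0 Q_0 fps_power_zeroth)

text \<open>
  The formal counterpart of \<open>\<tau>\<close>, whose sum over all pairs is \<open>s(Q, V)\<^sup>-\<^sup>2\<close>.
\<close>

definition T :: "nat \<Rightarrow> nat \<Rightarrow> real fps" where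
  "T i j = fps_inner (V i - V j) (V i - V j) / fps_norm (Q i - Q j) ^ 2
    + M_fps N G m Q i j / fps_norm (Q i - Q j)"

lemma s_fps_eq: "s_fps N G m Q V = fps_rpow (\<Sum>(i, j)\<in>pairs. T i j) (- 1 / 2)"
  by (simp add: s_fps_def T_def sum.Sigma sum.distrib case_prod_beta)

lemma K_fps_0:
  assumes "i \<in> {1..N}"
  shows "K_fps N G m Q i $ 0 = K i"
  unfolding K_fps_def K_bound_def fps_sum_nth
  by (rule sum.cong)
    (use assms in \<open>auto simp: fps_divide_norm_power fps_norm_nth_0 fps_power_zeroth Q_0 divide_inverse\<close>)

lemma T_0:
  assumes "i \<in> {1..N}" and "j \<in> {1..N}" and "i \<noteq> j"
  shows "T i j $ 0 = \<tau> i j"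
  using assms fps_divide_norm_power[OF assms, of _ 2] fps_divide_norm_power[OF assms, of _ 1]
  by (simp add: T_def \<tau>_def M_fps_def M_bound_def K_fps_0 fps_norm_nth_0 fps_power_zeroth Q_0 V_0
      fps_inner_def power2_norm_eq_inner divide_inverse)

text \<open>
  The induction step: from the bounds up to order \<open>n\<close> on the differences of positions and velocities
  follow bounds up to order \<open>Suc n\<close> on the increments in the midpoint equations. In the majorants of
  the increments, the factors of \<open>d i j\<close> and \<open>s0 * M i j\<close> are \<open>\<xi> - 1\<close> and \<open>\<zeta>\<close> at a fixed point of \<open>Psi\<close>.
\<close>

context
  fixes \<xi> \<zeta> :: "real fps" and n :: nat
  assumes \<xi>_0: "\<xi> $ 0 = 1" and \<zeta>_0: "\<zeta> $ 0 = 0"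
    and Q_maj: "\<And>i j. i \<in> {1..N} \<Longrightarrow> j \<in> {1..N} \<Longrightarrow> i \<noteq> j \<Longrightarrow>
      Q i - Q j \<unlhd>[n] fps_const (d i j) * \<xi>"
    and V_maj: "\<And>i j. i \<in> {1..N} \<Longrightarrow> j \<in> {1..N} \<Longrightarrow> i \<noteq> j \<Longrightarrow>
      V i - V j \<unlhd>[n] fps_const (w i j) + fps_const (s0 * M i j) * \<zeta>"
begin

text \<open>
  A series that majorizes another one has nonnegative coefficients; comparing with the first two
  bodies carries this over to \<open>\<xi>\<close> and \<open>\<zeta>\<close>.
\<close>

lemma \<xi>_nonneg: "nonneg_upto n \<xi>"
  unfolding zero_majorized_upto_iff
proof (intro allI impI)
  fix k assume "k \<le> n"
  then have "0 \<le> d 1 2 * \<xi> $ k"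
    using majorized_upto_nonneg[OF Q_maj[of 1 2]] N by simp
  then show "0 \<le> \<xi> $ k"
    using d_pos[of 1 2] N by (simp add: zero_le_mult_iff)
qed

lemma \<zeta>_nonneg: "nonneg_upto n \<zeta>"
  unfolding zero_majorized_upto_iff
proof (intro allI impI)
  fix k assume k: "k \<le> n"
  show "0 \<le> \<zeta> $ k"
  proof (cases "k = 0")
    case False
    then have "0 \<le> s0 * M 1 2 * \<zeta> $ k"
      using majorized_upto_nonneg[OF V_maj[of 1 2] k] N by simp
    moreover have "s0 * M 1 2 > 0"
      using M_pos[of 1 2] s0_pos N by auto
    ultimately show ?thesis
      using zero_le_mult_iff[of "s0 * M 1 2" "\<zeta> $ k"] by linarith
  qed (simp add: \<zeta>_0)
qed

abbreviation R :: "real \<Rightarrow> real fps" where "R \<nu> \<equiv> fps_rpow (2 - \<xi>\<^sup>2) (- \<nu>)"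

lemma one_maj_R: "\<nu> > 0 \<Longrightarrow> (1 :: real fps) \<unlhd>[n] R \<nu>"
proof (rule one_majorized_upto_fps_rpow_minus)
  show "\<xi>\<^sup>2 $ 0 = 1"
    by (simp add: fps_power_zeroth \<xi>_0)
  have "\<xi>\<^sup>2 \<unlhd>[n] \<xi>\<^sup>2"
    by (intro majorized_upto_power majorized_upto_refl \<xi>_nonneg)
  then show "nonneg_upto n (\<xi>\<^sup>2)"
    using majorized_upto_nonneg zero_majorized_upto_iff by blast
qed

lemma inverse_norm_maj:
  assumes "i \<in> {1..N}" and "j \<in> {1..N}" and "i \<noteq> j" and "k > 0"
  shows "inverse (fps_norm (Q i - Q j) ^ k) \<unlhd>[n] fps_const (1 / d i j ^ k) * R (real k / 2)"
  using fps_inverse_norm_power_majorized_upto[OF _ \<xi>_0 \<open>k > 0\<close>, of "Q i - Q j" n]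
    assms Q_maj[of i j] distinct[of i j] by (simp add: Q_0)

lemma K_maj:
  assumes i: "i \<in> {1..N}"
  shows "K_fps N G m Q i \<unlhd>[n] fps_const (K i) * R 1"
proof -
  have "K_fps N G m Q i \<unlhd>[n] (\<Sum>j\<in>{1..N} - {i}. fps_const (G * m j / (d i j)\<^sup>2) * R 1)"
    unfolding K_fps_def
  proof (rule majorized_upto_sum)
    fix j assume j: "j \<in> {1..N} - {i}"
    have "fps_const (G * m j) * inverse (fps_norm (Q i - Q j) ^ 2)
        \<unlhd>[n] fps_const (G * m j) * (fps_const (1 / (d i j)\<^sup>2) * R 1)"
      using i j G m[of j] inverse_norm_maj[of i j 2]
      by (intro majorized_upto_mult majorized_upto_const) auto
    then show "fps_const (G * m j) / fps_norm (Q i - Q j) ^ 2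
        \<unlhd>[n] fps_const (G * m j / (d i j)\<^sup>2) * R 1"
      using i j by (simp add: fps_divide_norm_power flip: mult.assoc)
  qed
  then show ?thesis
    by (simp only: sum_fps_const_mult K_bound_def)
qed

text \<open>
  The inverse cube of the distance contributes \<open>d\<^sup>-\<^sup>3\<close> and the difference of positions \<open>d\<close>; the
  resulting weights \<open>G m\<^sub>j / d\<^sup>2\<close> are the summands of \<open>K i\<close>.
\<close>

lemma g_maj:
  assumes i: "i \<in> {1..N}"
  shows "g_fps N G m Q i \<unlhd>[n] fps_const (K i) * (\<xi> * R (3 / 2))"
proof -
  have "g_fps N G m Q i
      \<unlhd>[n] (\<Sum>j\<in>{1..N} - {i}. fps_const (G * m j / (d i j)\<^sup>2) * (\<xi> * R (3 / 2)))"
    unfolding g_fps_def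
  proof (rule majorized_upto_sum)
    fix j assume j: "j \<in> {1..N} - {i}"
    have "(fps_const (G * m j) * inverse (fps_norm (Q i - Q j) ^ 3)) *\<^sub>F (Q j - Q i)
        \<unlhd>[n] (fps_const (G * m j) * (fps_const (1 / (d i j) ^ 3) * R (3 / 2)))
          * (fps_const (d i j) * \<xi>)"
      using i j G m[of j] inverse_norm_maj[of i j 3] Q_maj[of i j]
      by (intro majorized_upto_scale majorized_upto_mult majorized_upto_const)
        (auto simp: majorized_upto_minus_commute[of "Q i"])
    also have "fps_const (G * m j) * (fps_const (1 / (d i j) ^ 3) * R (3 / 2))
          * (fps_const (d i j) * \<xi>)
        = fps_const (G * m j * (1 / (d i j) ^ 3) * d i j) * (\<xi> * R (3 / 2))"
      by (simp only: mult_ac flip: fps_const_mult)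
    also have "G * m j * (1 / (d i j) ^ 3) * d i j = G * m j / (d i j)\<^sup>2"
      using i j d_pos[of i j] by (simp add: field_simps power2_eq_square power3_eq_cube)
    finally show "(fps_const (G * m j) / fps_norm (Q i - Q j) ^ 3) *\<^sub>F (Q j - Q i)
        \<unlhd>[n] fps_const (G * m j / (d i j)\<^sup>2) * (\<xi> * R (3 / 2))"
      using i j by (simp add: fps_divide_norm_power)
  qed
  then show ?thesis
    by (simp only: sum_fps_const_mult K_bound_def)
qed

lemma chi_eq: "chi \<xi> \<zeta> = 2 * (\<zeta> * R 1) + \<zeta>\<^sup>2 * R 1 + R 1 * R (1 / 2)"
  by (simp add: chi_def algebra_simps)

lemma majorant_nonneg:
  "nonneg_upto n (R 1)" "nonneg_upto n (R (1 / 2))" "nonneg_upto n (\<zeta> * R 1)"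
  "nonneg_upto n (\<zeta>\<^sup>2 * R 1)" "nonneg_upto n (R 1 * R (1 / 2))" "nonneg_upto n (chi \<xi> \<zeta>)"
proof -
  have R: "nonneg_upto n (R \<nu>)" if "\<nu> > 0" for \<nu>
    using one_maj_R[OF that] majorized_upto_nonneg by (auto simp: zero_majorized_upto_iff)
  have mult: "nonneg_upto n (f * h)" if "nonneg_upto n f" "nonneg_upto n h" for f h :: "real fps"
    using majorized_upto_mult[OF that] by simp
  have add: "nonneg_upto n (f + h)" if "nonneg_upto n f" "nonneg_upto n h" for f h :: "real fps"
    using majorized_upto_add[OF that] by simp
  show "nonneg_upto n (R 1)" "nonneg_upto n (R (1 / 2))" by (simp_all add: R)
  show "nonneg_upto n (\<zeta> * R 1)" "nonneg_upto n (\<zeta>\<^sup>2 * R 1)" "nonneg_upto n (R 1 * R (1 / 2))"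
    using mult[OF \<zeta>_nonneg \<zeta>_nonneg] by (simp_all add: mult R \<zeta>_nonneg flip: power2_eq_square)
  then show "nonneg_upto n (chi \<xi> \<zeta>)"
    unfolding chi_eq mult_2 by (intro add)
qed

text \<open>
  Expanding the majorant \<open>(w + s0 M \<zeta>)\<^sup>2 / d\<^sup>2\<close> of the kinetic part gives three terms. The mixed one
  and the one in \<open>\<zeta>\<^sup>2\<close> are reduced by \<open>s0 w \<le> d\<close> and \<open>s0\<^sup>2 M \<le> d\<close> to \<open>M / d\<close> times \<open>2 \<zeta>\<close> and
  \<open>\<zeta>\<^sup>2\<close>, and together with the gravitational part they add up to \<open>M / d\<close> times \<open>chi \<xi> \<zeta>\<close>. The
  remaining term \<open>w\<^sup>2 / d\<^sup>2 (2 - \<xi>\<^sup>2)\<^sup>-\<^sup>1\<close> has the correct weight, since \<open>(2 - \<xi>\<^sup>2)\<^sup>-\<^sup>1\<close> is majorized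
  by \<open>chi \<xi> \<zeta>\<close>.
\<close>

lemma T_maj:
  assumes ij: "i \<in> {1..N}" "j \<in> {1..N}" "i \<noteq> j"
  shows "T i j \<unlhd>[n] fps_const (\<tau> i j) * chi \<xi> \<zeta>"
proof -
  define a where "a = w i j"
  define u where "u = s0 * M i j"
  define b where "b = 1 / d i j"
  have d: "d i j > 0" and M: "M i j > 0"
    using ij d_pos M_pos by auto
  have b: "b > 0" and a: "a \<ge> 0"
    using d by (simp_all add: a_def b_def)
  have s0a: "s0 * a * b \<le> 1" and s0M: "s0\<^sup>2 * M i j * b \<le> 1"
    using s0_w_le_d[OF ij] s0_square_M_le_d[OF ij] d by (simp_all add: a_def b_def divide_le_eq)
  have inner: "fps_inner (V i - V j) (V i - V j) / fps_norm (Q i - Q j) ^ 2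
      \<unlhd>[n] (fps_const a + fps_const u * \<zeta>) * (fps_const a + fps_const u * \<zeta>)
        * (fps_const (b\<^sup>2) * R 1)"
    using V_maj[OF ij] inverse_norm_maj[OF ij, of 2] unfolding fps_divide_norm_power[OF ij]
    by (intro majorized_upto_mult majorized_upto_inner) (simp_all add: a_def u_def b_def power_divide)
  also have "(fps_const a + fps_const u * \<zeta>) * (fps_const a + fps_const u * \<zeta>)
        * (fps_const (b\<^sup>2) * R 1)
      = fps_const (a\<^sup>2 * b\<^sup>2) * R 1 + (fps_const (a * u * b\<^sup>2) * (2 * (\<zeta> * R 1))
        + fps_const (u\<^sup>2 * b\<^sup>2) * (\<zeta>\<^sup>2 * R 1))"
    by (simp add: power2_eq_square algebra_simps flip: fps_const_mult)
  finally have T1: "fps_inner (V i - V j) (V i - V j) / fps_norm (Q i - Q j) ^ 2 \<unlhd>[n] \<dots>" .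
  have "M_fps N G m Q i j / fps_norm (Q i - Q j) ^ 1
      \<unlhd>[n] (fps_const (K i) * R 1 + fps_const (K j) * R 1) * (fps_const b * R (1 / 2))"
    using K_maj ij inverse_norm_maj[OF ij, of 1]
    unfolding fps_divide_norm_power[OF ij] M_fps_def
    by (intro majorized_upto_mult majorized_upto_add) (simp_all add: b_def)
  also have "(fps_const (K i) * R 1 + fps_const (K j) * R 1) * (fps_const b * R (1 / 2))
      = fps_const (M i j * b) * (R 1 * R (1 / 2))"
    by (simp add: M_bound_def algebra_simps flip: fps_const_mult fps_const_add)
  finally have T2: "M_fps N G m Q i j / fps_norm (Q i - Q j) \<unlhd>[n] \<dots>"
    by simp
  have R1_chi: "R 1 \<unlhd>[n] chi \<xi> \<zeta>"
  proof -
    have "R 1 \<unlhd>[n] R 1 * R (1 / 2)"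
      using majorized_upto_mult[OF majorized_upto_refl[OF majorant_nonneg(1)] one_maj_R[of "1 / 2"]]
      by simp
    moreover have "nonneg_upto n (2 * (\<zeta> * R 1) + \<zeta>\<^sup>2 * R 1)"
      using majorant_nonneg(3,4) unfolding mult_2 by (simp add: zero_majorized_upto_iff)
    ultimately have "0 + R 1 \<unlhd>[n] chi \<xi> \<zeta>"
      unfolding chi_eq by (intro majorized_upto_add)
    then show ?thesis by simp
  qed
  have "T i j \<unlhd>[n] (fps_const (a\<^sup>2 * b\<^sup>2) * R 1 + (fps_const (a * u * b\<^sup>2) * (2 * (\<zeta> * R 1))
        + fps_const (u\<^sup>2 * b\<^sup>2) * (\<zeta>\<^sup>2 * R 1))) + fps_const (M i j * b) * (R 1 * R (1 / 2))"
    unfolding T_def by (intro majorized_upto_add T1 T2)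
  also have "\<dots> = fps_const (a\<^sup>2 * b\<^sup>2) * R 1 + (fps_const (a * u * b\<^sup>2) * (2 * (\<zeta> * R 1))
        + fps_const (u\<^sup>2 * b\<^sup>2) * (\<zeta>\<^sup>2 * R 1) + fps_const (M i j * b) * (R 1 * R (1 / 2)))"
    by (simp only: add.assoc)
  finally have T3: "T i j \<unlhd>[n] \<dots>" .
  have c1: "a * u * b\<^sup>2 \<le> M i j * b"
    using mult_right_mono[OF s0a, of "M i j * b"] M b
    by (simp add: u_def power2_eq_square mult_ac)
  have c2: "u\<^sup>2 * b\<^sup>2 \<le> M i j * b"
    using mult_right_mono[OF s0M, of "M i j * b"] M b
    by (simp add: u_def power2_eq_square mult_ac)
  have coeffs: "0 \<le> a\<^sup>2 * b\<^sup>2" "0 \<le> a * u * b\<^sup>2" "0 \<le> u\<^sup>2 * b\<^sup>2" "0 \<le> M i j * b"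
    using a b M s0_pos by (simp_all add: u_def)
  have nonneg_2: "nonneg_upto n (2 * (\<zeta> * R 1))"
    using majorant_nonneg(3) unfolding mult_2 by (simp add: zero_majorized_upto_iff)
  have scaled: "fps_const x * h \<unlhd>[n] fps_const y * h"
    if "0 \<le> x" "x \<le> y" "nonneg_upto n h" for x y and h :: "real fps"
    using that by (intro majorized_upto_mult majorized_upto_const majorized_upto_refl) auto
  have "fps_const (a\<^sup>2 * b\<^sup>2) * R 1 + (fps_const (a * u * b\<^sup>2) * (2 * (\<zeta> * R 1))
        + fps_const (u\<^sup>2 * b\<^sup>2) * (\<zeta>\<^sup>2 * R 1) + fps_const (M i j * b) * (R 1 * R (1 / 2)))
      \<unlhd>[n] fps_const (a\<^sup>2 * b\<^sup>2) * chi \<xi> \<zeta> + (fps_const (M i j * b) * (2 * (\<zeta> * R 1))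
        + fps_const (M i j * b) * (\<zeta>\<^sup>2 * R 1) + fps_const (M i j * b) * (R 1 * R (1 / 2)))"
    using coeffs c1 c2 nonneg_2 majorant_nonneg R1_chi
    by (intro majorized_upto_add scaled majorized_upto_mult majorized_upto_const) auto
  also have "\<dots> = fps_const (a\<^sup>2 * b\<^sup>2 + M i j * b) * chi \<xi> \<zeta>"
    unfolding fps_const_add[symmetric] distrib_right chi_eq by (simp only: distrib_left)
  also have "a\<^sup>2 * b\<^sup>2 + M i j * b = \<tau> i j"
    by (simp add: \<tau>_def a_def b_def power_divide)
  finally show ?thesis
    by (rule majorized_upto_trans[OF T3])
qed

abbreviation Y :: "real fps" where "Y \<equiv> fps_rpow (2 - chi \<xi> \<zeta>) (- (1 / 2))"

text \<open>
  The pairwise bounds share the factor \<open>chi \<xi> \<zeta>\<close>, whose constant term is 1, so they sum to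
  \<open>\<sigma> * chi \<xi> \<zeta>\<close>, and the power \<open>- 1 / 2\<close> may be taken.
\<close>

lemma s_maj: "s_fps N G m Q V \<unlhd>[n] fps_const s0 * Y"
proof -
  have "(\<Sum>(i, j)\<in>pairs. T i j) \<unlhd>[n] (\<Sum>(i, j)\<in>pairs. fps_const (\<tau> i j) * chi \<xi> \<zeta>)"
    by (rule majorized_upto_sum) (auto intro: T_maj)
  also have "\<dots> = fps_const \<sigma> * chi \<xi> \<zeta>"
    by (simp add: \<sigma>_def case_prod_beta sum_fps_const_mult)
  finally have S: "(\<Sum>(i, j)\<in>pairs. T i j) \<unlhd>[n] fps_const \<sigma> * chi \<xi> \<zeta>" .
  have "(\<Sum>(i, j)\<in>pairs. T i j) $ 0 = \<sigma>"
    unfolding \<sigma>_def fps_sum_nth by (rule sum.cong) (auto simp: T_0)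
  with S show ?thesis
    using fps_rpow_minus_majorized_upto[of "1 / 2" "\<Sum>(i, j)\<in>pairs. T i j" "chi \<xi> \<zeta>" n]
    by (simp add: s_fps_eq s0_eq \<sigma>_pos chi_nth_0[OF \<xi>_0 \<zeta>_0])
qed

lemma Y_nonneg: "nonneg_upto n Y"
  unfolding zero_majorized_upto_iff
proof (intro allI impI)
  fix k assume "k \<le> n"
  then have "0 \<le> s0 * Y $ k"
    using majorized_upto_nonneg[OF s_maj] by simp
  then show "0 \<le> Y $ k"
    using s0_pos by (simp add: zero_le_mult_iff)
qed

text \<open>
  The factor \<open>s0\<close> of the majorant of \<open>s(Q, V)\<close> turns \<open>w + s0 M \<zeta>\<close> into \<open>s0 w + s0\<^sup>2 M \<zeta>\<close>, which is at
  most \<open>d (1 + \<zeta>)\<close>.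
\<close>

lemma Q_increment_maj:
  assumes ij: "i \<in> {1..N}" "j \<in> {1..N}" "i \<noteq> j"
  shows "(fps_X * (fps_const (1 / 2) * s_fps N G m Q V)) *\<^sub>F (V i - V j)
    \<unlhd>[Suc n] fps_const (d i j) * (fps_X * (fps_const (1 / 2) * (Y * (1 + \<zeta>))))"
proof -
  have M: "M i j > 0" using ij M_pos by auto
  have "(fps_X * (fps_const (1 / 2) * s_fps N G m Q V)) *\<^sub>F (V i - V j)
      \<unlhd>[Suc n] fps_X * ((fps_const (1 / 2) * (fps_const s0 * Y))
        * (fps_const (w i j) + fps_const (s0 * M i j) * \<zeta>))"
    by (intro fps_X_mult_scale_majorized_upto majorized_upto_mult majorized_upto_const s_maj V_maj ij)
      simp
  also have "(fps_const (1 / 2) * (fps_const s0 * Y))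
        * (fps_const (w i j) + fps_const (s0 * M i j) * \<zeta>)
      = (fps_const (1 / 2) * Y) * (fps_const (s0 * w i j) + fps_const (s0\<^sup>2 * M i j) * \<zeta>)"
    by (simp only: power2_eq_square algebra_simps flip: fps_const_mult)
  finally have "(fps_X * (fps_const (1 / 2) * s_fps N G m Q V)) *\<^sub>F (V i - V j)
      \<unlhd>[Suc n] fps_X * \<dots>" .
  moreover have "fps_X * ((fps_const (1 / 2) * Y)
        * (fps_const (s0 * w i j) + fps_const (s0\<^sup>2 * M i j) * \<zeta>))
      \<unlhd>[Suc n] fps_X * ((fps_const (1 / 2) * Y) * (fps_const (d i j) + fps_const (d i j) * \<zeta>))"
    using s0_w_le_d[OF ij] s0_square_M_le_d[OF ij] s0_pos M
    by (intro fps_X_mult_majorized_upto majorized_upto_mult majorized_upto_add majorized_upto_const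
        majorized_upto_refl Y_nonneg \<zeta>_nonneg) auto
  ultimately have "(fps_X * (fps_const (1 / 2) * s_fps N G m Q V)) *\<^sub>F (V i - V j)
      \<unlhd>[Suc n] fps_X * ((fps_const (1 / 2) * Y) * (fps_const (d i j) + fps_const (d i j) * \<zeta>))"
    by (rule majorized_upto_trans)
  also have "fps_X * ((fps_const (1 / 2) * Y) * (fps_const (d i j) + fps_const (d i j) * \<zeta>))
      = fps_const (d i j) * (fps_X * (fps_const (1 / 2) * (Y * (1 + \<zeta>))))"
    by (simp only: algebra_simps mult_1_left mult_1_right)
  finally show ?thesis .
qed

text \<open>
  Nothing is lost beyond the bounds on \<open>s(Q, V)\<close> and the accelerations: the triangle inequality
  adds \<open>K i\<close> and \<open>K j\<close> to \<open>M i j\<close>.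
\<close>

lemma V_increment_maj:
  assumes ij: "i \<in> {1..N}" "j \<in> {1..N}" "i \<noteq> j"
  shows "(fps_X * (fps_const (1 / 2) * s_fps N G m Q V)) *\<^sub>F (g_fps N G m Q i - g_fps N G m Q j)
    \<unlhd>[Suc n] fps_const (s0 * M i j) * (fps_X * (fps_const (1 / 2) * (Y * (\<xi> * R (3 / 2)))))"
proof -
  have "(fps_X * (fps_const (1 / 2) * s_fps N G m Q V)) *\<^sub>F (g_fps N G m Q i - g_fps N G m Q j)
      \<unlhd>[Suc n] fps_X * ((fps_const (1 / 2) * (fps_const s0 * Y))
        * (fps_const (K i) * (\<xi> * R (3 / 2)) + fps_const (K j) * (\<xi> * R (3 / 2))))"
    by (intro fps_X_mult_scale_majorized_upto majorized_upto_mult majorized_upto_const s_maj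
        majorized_upto_diff g_maj ij) simp
  also have "\<dots> = fps_const (s0 * M i j) * (fps_X * (fps_const (1 / 2) * (Y * (\<xi> * R (3 / 2)))))"
    by (simp only: M_bound_def algebra_simps flip: fps_const_mult fps_const_add)
  finally show ?thesis .
qed

end

end

theorem theorem4:
  fixes N :: nat and G :: real and m :: "nat \<Rightarrow> real"
    and q0 v0 :: "nat \<Rightarrow> real ^ 3"
    and Q V :: "nat \<Rightarrow> (real ^ 3) fps"
  assumes "N \<ge> 2"
    and "G > 0"
    and "\<And>i. i \<in> {1..N} \<Longrightarrow> m i > 0"
    and "\<And>i j. 1 \<le> i \<Longrightarrow> i < j \<Longrightarrow> j \<le> N \<Longrightarrow> q0 i \<noteq> q0 j"
    and "midpoint_series N G m q0 v0 Q V"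
  shows "(\<exists>!p. p \<in> Psi_domain \<and> Psi p = p) \<and>
    (\<forall>\<xi> \<zeta>. (\<xi>, \<zeta>) \<in> Psi_domain \<and> Psi (\<xi>, \<zeta>) = (\<xi>, \<zeta>) \<longrightarrow>
      (\<forall>i j. 1 \<le> i \<and> i < j \<and> j \<le> N \<longrightarrow>
        Q i - Q j \<unlhd> fps_const (norm (q0 i - q0 j)) * \<xi> \<and>
        V i - V j \<unlhd> fps_const (norm (v0 i - v0 j)) +
          fps_const (s_fun N G m q0 v0 * M_bound N G m q0 i j) * \<zeta>))"
proof (intro conjI allI impI)
  show "\<exists>!p. p \<in> Psi_domain \<and> Psi p = p"
    by (rule ex1_Psi_fixed_point)
next
  fix \<xi> \<zeta> i j
  assume fixed: "(\<xi>, \<zeta>) \<in> Psi_domain \<and> Psi (\<xi>, \<zeta>) = (\<xi>, \<zeta>)"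
    and ij: "1 \<le> i \<and> i < j \<and> j \<le> N"
  define s where "s = fps_X * (fps_const (1 / 2) * s_fps N G m Q V)"
  have Q: "Q i = fps_const (q0 i) + s *\<^sub>F V i"
    and V: "V i = fps_const (v0 i) + s *\<^sub>F g_fps N G m Q i" if "i \<in> {1..N}" for i
    using assms(5) that by (simp_all add: midpoint_series_def s_def fps_X_half mult.assoc)
  have scale_0: "(s *\<^sub>F f) $ 0 = 0" for f :: "(real ^ 3) fps"
    by (simp add: s_def fps_scale_def)
  interpret nbody_series N G m q0 v0 Q V
  proof
    show "q0 i \<noteq> q0 j" if "i \<in> {1..N}" "j \<in> {1..N}" "i \<noteq> j" for i j
      using assms(4)[of i j] assms(4)[of j i] that by (cases "i < j") auto
    show "Q i $ 0 = q0 i" if "i \<in> {1..N}" for i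
      using scale_0[of "V i"] by (subst Q[OF that]) simp
    show "V i $ 0 = v0 i" if "i \<in> {1..N}" for i
      using scale_0[of "g_fps N G m Q i"] by (subst V[OF that]) simp
  qed (use assms in auto)
  have \<xi>_0: "\<xi> $ 0 = 1" and \<zeta>_0: "\<zeta> $ 0 = 0"
    using fixed by (simp_all add: Psi_domain_def)
  have \<xi>: "\<xi> = 1 + fps_X * (fps_const (1 / 2) * (fps_rpow (2 - chi \<xi> \<zeta>) (- (1 / 2)) * (1 + \<zeta>)))"
    and \<zeta>: "\<zeta> = fps_X * (fps_const (1 / 2) *
        (fps_rpow (2 - chi \<xi> \<zeta>) (- (1 / 2)) * (\<xi> * fps_rpow (2 - \<xi>\<^sup>2) (- (3 / 2)))))"
    using fixed Psi_eq[OF \<xi>_0, of \<zeta>] by simp_all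
  have *: "\<forall>i\<in>{1..N}. \<forall>j\<in>{1..N}. i \<noteq> j \<longrightarrow> Q i - Q j \<unlhd>[n] fps_const (d i j) * \<xi> \<and>
      V i - V j \<unlhd>[n] fps_const (w i j) + fps_const (s0 * M i j) * \<zeta>" for n
  proof (induction n)
    case 0
    show ?case
      by (simp add: majorized_upto_def Q_0 V_0 \<xi>_0 \<zeta>_0)
  next
    case (Suc n)
    show ?case
    proof (intro ballI impI conjI)
      fix i j assume ij: "i \<in> {1..N}" "j \<in> {1..N}" "i \<noteq> j"
      have "Q i - Q j = fps_const (q0 i - q0 j) + s *\<^sub>F (V i - V j)"
        by (subst Q[OF ij(1)], subst Q[OF ij(2)]) (simp add: fps_scale_diff_right flip: fps_const_sub)
      also have "\<dots> \<unlhd>[Suc n] fps_const (d i j) + fps_const (d i j) * (fps_X * (fps_const (1 / 2) *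
          (fps_rpow (2 - chi \<xi> \<zeta>) (- (1 / 2)) * (1 + \<zeta>))))"
        unfolding s_def using Suc.IH ij
        by (intro majorized_upto_add majorized_upto_const Q_increment_maj \<xi>_0 \<zeta>_0) auto
      also have "\<dots> = fps_const (d i j) * \<xi>"
        by (subst (2) \<xi>) (simp only: distrib_left mult_1_right)
      finally show "Q i - Q j \<unlhd>[Suc n] fps_const (d i j) * \<xi>" .
      have "V i - V j = fps_const (v0 i - v0 j) + s *\<^sub>F (g_fps N G m Q i - g_fps N G m Q j)"
        by (subst V[OF ij(1)], subst V[OF ij(2)]) (simp add: fps_scale_diff_right flip: fps_const_sub)
      also have "\<dots> \<unlhd>[Suc n] fps_const (w i j) + fps_const (s0 * M i j) * (fps_X * (fps_const (1 / 2) *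
          (fps_rpow (2 - chi \<xi> \<zeta>) (- (1 / 2)) * (\<xi> * fps_rpow (2 - \<xi>\<^sup>2) (- (3 / 2))))))"
        unfolding s_def using Suc.IH ij
        by (intro majorized_upto_add majorized_upto_const V_increment_maj \<xi>_0 \<zeta>_0) auto
      finally show "V i - V j \<unlhd>[Suc n] fps_const (w i j) + fps_const (s0 * M i j) * \<zeta>"
        using \<zeta> by simp
    qed
  qed
  show "Q i - Q j \<unlhd> fps_const (d i j) * \<xi>"
    and "V i - V j \<unlhd> fps_const (w i j) + fps_const (s0 * M i j) * \<zeta>"
    using * ij by (simp_all add: fps_majorized_iff)
qed

end
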